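(* Let $V$ be a Hilbert space with a localizing space decomposition with local spaces $V_1,\dots,V_N$ and mappings $\mathcal{P}_{V_i}:V\to V_i$, and suppose that $\{1,\dots,N\}$ can be partitioned into $\bar J$ classes such that $V_i\perp V_j$ whenever $i\ne j$ belong to the same class. For each parameter $\mu$ in a parameter set $\mathcal{D}$ let $a_\mu$ be a continuous coercive form on $V$ with coercivity constant $\alpha_\mu>0$ and continuity constant $\gamma_\mu$, let $f_\mu$ be a continuous functional on $V$, let $u_\mu\in V$ solve $a_\mu(u_\mu,v)=f_\mu(v)$ for all $v\in V$, and let $\widetilde u_\mu\in\widetilde V$ solve $a_\mu(\widetilde u_\mu,v)=f_\mu(v)$ for all $v\in\widetilde V$, where $\widetilde V\subseteq V$ is a subspace. Let $\mathcal{R}_\mu(\widetilde u_\mu)\in V'$, $\mathcal{R}_\mu(\widetilde u_\mu)(\varphi):=f_\mu(\varphi)-a_\mu(\widetilde u_\mu,\varphi)$, be the residual and define $$\Delta^l_{loc}(\widetilde u_\mu):=\frac{1}{\alpha_\mu}\sum_{i=1}^N c_{i,\widetilde V}\,\|\mathcal{R}_\mu(\widetilde u_\mu)\|_{V_i'},\qquad \Delta^g_{loc}(\widetilde u_\mu):=\frac{1}{\alpha_\mu}\,c_{\mathrm{pu},\widetilde V}\Big(\sum_{i=1}^N\|\mathcal{R}_\mu(\widetilde u_\mu)\|_{V_i'}^2\Big)^{1/2},$$ where, with $P_{\widetilde V\cap V_i}$ the orthogonal projection onto $\widetilde V\cap V_i$, $$c_{i,\widetilde V}:=\sup_{\varphi\in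 V\setminus\{0\}}\frac{\|(1-P_{\widetilde V\cap V_i})\mathcal{P}_{V_i}(\varphi)\|}{\|\varphi\|},\qquad c_{\mathrm{pu},\widetilde V}:=\sup_{\varphi\in V\setminus\{0\}}\frac{\big(\sum_{i=1}^N\|(1-P_{\widetilde V\cap V_i})\mathcal{P}_{V_i}(\varphi)\|^2\big)^{1/2}}{\|\varphi\|} .$$ Then for all $\mu\in\mathcal{D}$, $$\|u_\mu-\widetilde u_\mu\|_V\le\Delta^l_{loc}(\widetilde u_\mu)\le\frac{\gamma_\mu}{\alpha_\mu}\Big(\sum_{i=1}^N c_{i,\widetilde V}^2\Big)^{1/2}\sqrt{\bar J}\,\|u_\mu-\widetilde u_\mu\|_V,$$ $$\|u_\mu-\widetilde u_\mu\|_V\le\Delta^g_{loc}(\widetilde u_\mu)\le\frac{\gamma_\mu}{\alpha_\mu}\,c_{\mathrm{pu},\widetilde V}\sqrt{\bar J}\,\|u_\mu-\widetilde u_\mu\|_V .$$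
   Context: A localizing space decomposition consists of: an open, bounded, connected domain $\Omega\subset\mathbb{R}^d$ with smooth boundary; a Hilbert space $V$ of functions on $\Omega$ (over $\mathbb{K}=\mathbb{R}$ or $\mathbb{C}$; continuous or discrete); subdomains $\omega_1,\dots,\omega_N$ forming an overlapping or non-overlapping domain decomposition of $\Omega$; subspaces $V_1,\dots,V_N\subseteq V$ with $\sum_i V_i=V$ and $\operatorname{supp}\varphi\subseteq\omega_i$ for all $\varphi\in V_i$; and linear maps $\mathcal{P}_{V_i}:V\to V_i$ with $\sum_{i=1}^N\mathcal{P}_{V_i}(\varphi)=\varphi$ for all $\varphi\in V$. The form $a_\mu$ is bilinear (resp. sesquilinear, antilinear in the second argument) and $f_\mu$ linear (resp. antilinear). $\alpha_\mu:=\inf_{\varphi\ne0}|a_\mu(\varphi,\varphi)|/\|\varphi\|^2$ and $\gamma_\mu:=\sup_{\varphi_1,\varphi_2\neq0}|a_\mu(\varphi_1,\varphi_2)|/(\|\varphi_1\|\|\varphi_2\|)$, with infimum and supremum over $V$. Each $V_i$ carries the norm of $V$; for a subspace $W\subseteq V$, $\|F\|_{W'}:=\sup_{\varphi\in W\setminus\{0\}}|F(\varphi)|/\|\varphi\|$. Conventions: subspaces onto which orthogonal projections are taken are understood to be closed; constants defined as suprema may take the value $+\infty$, with $0\cdot\infty=0$. *)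

theory Defs
  imports "HOL-Analysis.Analysis"
begin

section \<open>Scalars: the real or the complex numbers\<close>

text \<open>
  Any type of this class is the real or the complex field: \<open>x\<close> is a root of the polynomial
  \<open>t\<^sup>2 - (x + kcnj x) t + x * kcnj x\<close>, whose coefficients are real (the second one
  since \<open>x + kcnj x = (1 + x) * kcnj (1 + x) - 1 - x * kcnj x\<close>), so the field is algebraic of
  degree at most 2 over the reals.
\<close>

class real_or_complex = real_normed_field +
  fixes kcnj :: "'a \<Rightarrow> 'a"
  assumes kcnj_add: "kcnj (x + y) = kcnj x + kcnj y"
    and kcnj_mult: "kcnj (x * y) = kcnj x * kcnj y"
    and kcnj_scaleR: "kcnj (r *\<^sub>R x) = r *\<^sub>R kcnj x"
    and mult_kcnj: "x * kcnj x = (norm x)\<^sup>2 *\<^sub>R 1"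

instantiation real :: real_or_complex
begin

definition "kcnj (x :: real) = x"

instance
  by standard (simp_all add: kcnj_real_def power2_eq_square)

end

instantiation complex :: real_or_complex
begin

definition "kcnj (z :: complex) = cnj z"

instance
proof
  fix z :: complex
  show "z * kcnj z = (norm z)\<^sup>2 *\<^sub>R 1"
    using complex_norm_square[of z] by (simp add: kcnj_complex_def scaleR_conv_of_real)
qed (simp_all add: kcnj_complex_def)

end


section \<open>Hilbert spaces and forms\<close>

text \<open>
  A Hilbert space over \<open>'k\<close> is a Banach space with an inner product inducing its norm.
  Completeness is part of the sort \<open>banach\<close>.
\<close>

locale hilbert_space = vector_space smul
  for smul :: "'k::real_or_complex \<Rightarrow> 'v::banach \<Rightarrow> 'v" +
  fixes ip :: "'v \<Rightarrow> 'v \<Rightarrow> 'k"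
  assumes scale_of_real: "smul (of_real r) v = r *\<^sub>R v"
    and ip_add_left: "ip (v + w) z = ip v z + ip w z"
    and ip_scale_left: "ip (smul c v) w = c * ip v w"
    and ip_commute: "ip w v = kcnj (ip v w)"
    and ip_self: "ip v v = of_real ((norm v)\<^sup>2)"

lemma hilbert_space_real:
  "hilbert_space scaleR (inner :: 'v::{real_inner, banach} \<Rightarrow> 'v \<Rightarrow> real)"
  by unfold_locales
    (simp_all add: inner_add_left inner_commute kcnj_real_def power2_norm_eq_inner algebra_simps)

definition orth_sets :: "('v \<Rightarrow> 'v \<Rightarrow> 'k::zero) \<Rightarrow> 'v set \<Rightarrow> 'v set \<Rightarrow> bool" where
  "orth_sets ip A B \<longleftrightarrow> (\<forall>x\<in>A. \<forall>y\<in>B. ip x y = 0)"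

text \<open>Well defined if \<open>W\<close> is a closed subspace of a Hilbert space.\<close>

definition orth_proj :: "('v::ab_group_add \<Rightarrow> 'v \<Rightarrow> 'k::zero) \<Rightarrow> 'v set \<Rightarrow> 'v \<Rightarrow> 'v" where
  "orth_proj ip W v = (THE p. p \<in> W \<and> (\<forall>w\<in>W. ip (v - p) w = 0))"

text \<open>
  Since \<open>kcnj\<close> is the identity on the reals, the next two notions reduce to
  linear and bilinear in the real case.
\<close>

definition antilinear_functional ::
  "('k::real_or_complex \<Rightarrow> 'v::ab_group_add \<Rightarrow> 'v) \<Rightarrow> ('v \<Rightarrow> 'k) \<Rightarrow> bool" where
  "antilinear_functional smul f \<longleftrightarrow>
     (\<forall>v w. f (v + w) = f v + f w) \<and> (\<forall>c v. f (smul c v) = kcnj c * f v)"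

definition sesquilinear_form ::
  "('k::real_or_complex \<Rightarrow> 'v::ab_group_add \<Rightarrow> 'v) \<Rightarrow> ('v \<Rightarrow> 'v \<Rightarrow> 'k) \<Rightarrow> bool" where
  "sesquilinear_form smul a \<longleftrightarrow>
     (\<forall>w. Vector_Spaces.linear smul (*) (\<lambda>v. a v w)) \<and>
     (\<forall>v. antilinear_functional smul (a v))"

definition coercivity_const :: "('v::real_normed_vector \<Rightarrow> 'v \<Rightarrow> 'k::real_normed_vector) \<Rightarrow> ennreal" where
  "coercivity_const a = (INF v\<in>UNIV - {0}. ennreal (norm (a v v) / (norm v)\<^sup>2))"

definition continuity_const :: "('v::real_normed_vector \<Rightarrow> 'v \<Rightarrow> 'k::real_normed_vector) \<Rightarrow> ennreal" where
  "continuity_const a =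
     (SUP v\<in>UNIV - {0}. SUP w\<in>UNIV - {0}. ennreal (norm (a v w) / (norm v * norm w)))"

definition dual_norm :: "'v::real_normed_vector set \<Rightarrow> ('v \<Rightarrow> 'k::real_normed_vector) \<Rightarrow> ennreal" where
  "dual_norm W F = (SUP v\<in>W - {0}. ennreal (norm (F v) / norm v))"

definition residual :: "('v \<Rightarrow> 'v \<Rightarrow> 'k::minus) \<Rightarrow> ('v \<Rightarrow> 'k) \<Rightarrow> 'v \<Rightarrow> 'v \<Rightarrow> 'k" where
  "residual a f ut v = f v - a ut v"

definition ennsqrt :: "ennreal \<Rightarrow> ennreal" where
  "ennsqrt x = (if x = top then top else ennreal (sqrt (enn2real x)))"


section \<open>Domains and supports\<close>

primrec Ck_on :: "nat \<Rightarrow> 'a::euclidean_space set \<Rightarrow> ('a \<Rightarrow> real) \<Rightarrow> bool" where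
  "Ck_on 0 U g \<longleftrightarrow> continuous_on U g"
| "Ck_on (Suc k) U g \<longleftrightarrow> (\<forall>x\<in>U. g differentiable (at x)) \<and>
     (\<forall>b\<in>Basis. Ck_on k U (\<lambda>x. frechet_derivative g (at x) b))"

text \<open>
  The boundary is smooth if \<open>\<Omega>\<close> is, near each boundary point, a strict sublevel set of a
  \<open>C\<^sup>\<infinity>\<close> function without critical points.
\<close>

definition smooth_boundary :: "'a::euclidean_space set \<Rightarrow> bool" where
  "smooth_boundary \<Omega> \<longleftrightarrow> (\<forall>p\<in>frontier \<Omega>. \<exists>U g.
     open U \<and> p \<in> U \<and> (\<forall>k. Ck_on k U g) \<and>
     (\<forall>x\<in>U. frechet_derivative g (at x) \<noteq> (\<lambda>_. 0)) \<and>
     \<Omega> \<inter> U = {x \<in> U. g x < 0})"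

definition overlapping_decomposition ::
  "'a::topological_space set \<Rightarrow> nat \<Rightarrow> (nat \<Rightarrow> 'a set) \<Rightarrow> bool" where
  "overlapping_decomposition \<Omega> N \<omega> \<longleftrightarrow>
     (\<forall>i\<in>{1..N}. open (\<omega> i) \<and> \<omega> i \<subseteq> \<Omega>) \<and> (\<Union>i\<in>{1..N}. \<omega> i) = \<Omega>"

definition nonoverlapping_decomposition ::
  "'a::topological_space set \<Rightarrow> nat \<Rightarrow> (nat \<Rightarrow> 'a set) \<Rightarrow> bool" where
  "nonoverlapping_decomposition \<Omega> N \<omega> \<longleftrightarrow>
     (\<forall>i\<in>{1..N}. open (\<omega> i) \<and> \<omega> i \<subseteq> \<Omega>) \<and>
     disjoint_family_on \<omega> {1..N} \<and> (\<Union>i\<in>{1..N}. closure (\<omega> i)) = closure \<Omega>"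

text \<open>
  The closed support of a function on \<open>space M\<close> that is only determined up to
  \<open>M\<close>-null sets; for a counting measure this is the usual support.
\<close>

definition ess_supp :: "'a::topological_space measure \<Rightarrow> ('a \<Rightarrow> 'e::zero) \<Rightarrow> 'a set" where
  "ess_supp M g = {x. \<forall>U. open U \<and> x \<in> U \<longrightarrow> \<not> (AE y in M. y \<in> U \<longrightarrow> g y = 0)}"

lemma ess_supp_count_space:
  "ess_supp (count_space \<Omega>) g = closure {x \<in> \<Omega>. g x \<noteq> 0}"
proof -
  have "x \<in> ess_supp (count_space \<Omega>) g \<longleftrightarrow> x \<in> closure {x \<in> \<Omega>. g x \<noteq> 0}" for x
  proof -
    have "x \<in> ess_supp (count_space \<Omega>) g \<longleftrightarrow>
        (\<forall>U. open U \<and> x \<in> U \<longrightarrow> {x \<in> \<Omega>. g x \<noteq> 0} \<inter> U \<noteq> {})"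
      by (auto simp: ess_supp_def AE_count_space)
    also have "\<dots> \<longleftrightarrow> (\<forall>A. x \<in> A \<and> open A \<longrightarrow> {x \<in> \<Omega>. g x \<noteq> 0} \<inter> A \<noteq> {})"
      by (simp add: conj_commute)
    also have "\<dots> \<longleftrightarrow> x \<in> closure {x \<in> \<Omega>. g x \<noteq> 0}"
      unfolding closure_iff_nhds_not_empty by blast
    finally show ?thesis .
  qed
  then show ?thesis by blast
qed


section \<open>Localizing space decompositions\<close>

text \<open>
  The vectors of the Hilbert space are functions on \<open>\<Omega>\<close>: \<open>fn v\<close> is a representative
  of \<open>v\<close>, with values in a vector space over \<open>'k\<close> (the field \<open>'k\<close> itself
  for scalar functions). They are either classes of functions up to Lebesgue null sets
  (\<open>M = lebesgue_on \<Omega>\<close>) or genuine functions (\<open>M = count_space \<Omega>\<close>, for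
  which almost everywhere means everywhere on \<open>\<Omega>\<close>).
  Subdomains are open whereas supports are closed, so a function is supported on \<open>\<omega> i\<close> if
  its support lies in the closure of \<open>\<omega> i\<close>.
\<close>

locale localizing_space_decomposition =
  hilbert_space smul ip + value_space: vector_space smulE
  for smul :: "'k::real_or_complex \<Rightarrow> 'v::banach \<Rightarrow> 'v"
    and ip :: "'v \<Rightarrow> 'v \<Rightarrow> 'k"
    and smulE :: "'k \<Rightarrow> 'e::ab_group_add \<Rightarrow> 'e" +
  fixes \<Omega> :: "(real ^ 'd) set"
    and M :: "(real ^ 'd) measure"
    and fn :: "'v \<Rightarrow> real ^ 'd \<Rightarrow> 'e"
    and N :: nat
    and \<omega> :: "nat \<Rightarrow> (real ^ 'd) set"
    and Vs :: "nat \<Rightarrow> 'v set"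
    and P :: "nat \<Rightarrow> 'v \<Rightarrow> 'v"
  assumes domain: "open \<Omega>" "bounded \<Omega>" "connected \<Omega>" "smooth_boundary \<Omega>"
    and identification: "M = lebesgue_on \<Omega> \<or> M = count_space \<Omega>"
    and fn_add: "AE x in M. fn (v + w) x = fn v x + fn w x"
    and fn_scale: "AE x in M. fn (smul c v) x = smulE c (fn v x)"
    and fn_inj: "(AE x in M. fn v x = 0) \<Longrightarrow> v = 0"
    and decomposition:
      "overlapping_decomposition \<Omega> N \<omega> \<or> nonoverlapping_decomposition \<Omega> N \<omega>"
    and local_subspace: "i \<in> {1..N} \<Longrightarrow> module.subspace smul (Vs i)"
    and local_sum: "\<exists>w. (\<forall>i\<in>{1..N}. w i \<in> Vs i) \<and> v = (\<Sum>i\<in>{1..N}. w i)"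
    and local_supp: "i \<in> {1..N} \<Longrightarrow> v \<in> Vs i \<Longrightarrow> ess_supp M (fn v) \<subseteq> closure (\<omega> i)"
    and map_linear: "i \<in> {1..N} \<Longrightarrow> Vector_Spaces.linear smul smul (P i)"
    and map_range: "i \<in> {1..N} \<Longrightarrow> P i v \<in> Vs i"
    and map_sum: "(\<Sum>i\<in>{1..N}. P i v) = v"


section \<open>Localized error estimators\<close>

text \<open>
  All constants live in \<open>ennreal\<close>, where suprema may be infinite and
  \<open>0 * top = 0\<close>.
\<close>

definition loc_const ::
  "('v::real_normed_vector \<Rightarrow> 'v \<Rightarrow> 'k::zero) \<Rightarrow> (nat \<Rightarrow> 'v set) \<Rightarrow> (nat \<Rightarrow> 'v \<Rightarrow> 'v) \<Rightarrow>
   'v set \<Rightarrow> nat \<Rightarrow> ennreal" where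
  "loc_const ip Vs P Vt i =
     (SUP v\<in>UNIV - {0}. ennreal (norm (P i v - orth_proj ip (Vt \<inter> Vs i) (P i v)) / norm v))"

definition pu_const ::
  "('v::real_normed_vector \<Rightarrow> 'v \<Rightarrow> 'k::zero) \<Rightarrow> nat \<Rightarrow> (nat \<Rightarrow> 'v set) \<Rightarrow> (nat \<Rightarrow> 'v \<Rightarrow> 'v) \<Rightarrow>
   'v set \<Rightarrow> ennreal" where
  "pu_const ip N Vs P Vt =
     (SUP v\<in>UNIV - {0}.
        ennreal (sqrt (\<Sum>i\<in>{1..N}. (norm (P i v - orth_proj ip (Vt \<inter> Vs i) (P i v)))\<^sup>2) / norm v))"

definition Delta_loc_l ::
  "('v::real_normed_vector \<Rightarrow> 'v \<Rightarrow> 'k::real_normed_vector) \<Rightarrow> nat \<Rightarrow> (nat \<Rightarrow> 'v set) \<Rightarrow>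
   (nat \<Rightarrow> 'v \<Rightarrow> 'v) \<Rightarrow> 'v set \<Rightarrow> ('v \<Rightarrow> 'v \<Rightarrow> 'k) \<Rightarrow> ('v \<Rightarrow> 'k) \<Rightarrow> 'v \<Rightarrow> ennreal" where
  "Delta_loc_l ip N Vs P Vt a f ut =
     1 / coercivity_const a *
     (\<Sum>i\<in>{1..N}. loc_const ip Vs P Vt i * dual_norm (Vs i) (residual a f ut))"

definition Delta_loc_g ::
  "('v::real_normed_vector \<Rightarrow> 'v \<Rightarrow> 'k::real_normed_vector) \<Rightarrow> nat \<Rightarrow> (nat \<Rightarrow> 'v set) \<Rightarrow>
   (nat \<Rightarrow> 'v \<Rightarrow> 'v) \<Rightarrow> 'v set \<Rightarrow> ('v \<Rightarrow> 'v \<Rightarrow> 'k) \<Rightarrow> ('v \<Rightarrow> 'k) \<Rightarrow> 'v \<Rightarrow> ennreal" where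
  "Delta_loc_g ip N Vs P Vt a f ut =
     1 / coercivity_const a * pu_const ip N Vs P Vt *
     ennsqrt (\<Sum>i\<in>{1..N}. (dual_norm (Vs i) (residual a f ut))\<^sup>2)"

end

theory Submission
  imports Defs
begin

text \<open>
  Fix a parameter, let \<open>\<alpha>\<close> and \<open>\<gamma>\<close> be the coercivity and continuity constants, \<open>e = u - ut\<close>
  the error and \<open>R\<close> the residual of \<open>ut\<close>. Then \<open>R v = a e v\<close> for all \<open>v\<close>, and \<open>R\<close> vanishes
  on \<open>Vt\<close>. Let \<open>z i = P i e - Q i (P i e)\<close>, where \<open>Q i\<close> is the orthogonal projection onto
  \<open>Vt \<inter> Vs i\<close>. As \<open>e\<close> is the sum of the \<open>P i e\<close> and \<open>R\<close> vanishes on each \<open>Vt \<inter> Vs i\<close>, one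
  gets \<open>a e e = R e = (\<Sum>i. R (z i))\<close>, with \<open>z i\<close> in \<open>Vs i\<close>. Hence
  \<open>\<alpha> * \<parallel>e\<parallel>\<^sup>2 \<le> (\<Sum>i. r i * \<parallel>z i\<parallel>)\<close>, where \<open>r i\<close> is the norm of \<open>R\<close> on \<open>Vs i\<close>. Bounding
  each \<open>\<parallel>z i\<parallel>\<close> by the local constant times \<open>\<parallel>e\<parallel>\<close>, or first applying the Cauchy-Schwarz
  inequality and then bounding \<open>(\<Sum>i. \<parallel>z i\<parallel>\<^sup>2)\<close> by the global constant, shows that the two
  estimators are upper bounds for \<open>\<parallel>e\<parallel>\<close>.

  The converse bounds rest on \<open>sum_dual_norm_le\<close>: on mutually orthogonal subspaces the
  squares of the dual norms of a functional add up to at most the square of its norm on the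
  whole space. Since \<open>\<bar>R v\<bar> \<le> \<gamma> * \<parallel>e\<parallel> * \<parallel>v\<parallel>\<close>, each class of the partition contributes at
  most \<open>(\<gamma> * \<parallel>e\<parallel>)\<^sup>2\<close> to \<open>(\<Sum>i. (r i)\<^sup>2)\<close>; for the first estimator this is combined with
  Cauchy-Schwarz.

  That \<open>Q i\<close> maps into \<open>Vt \<inter> Vs i\<close> is the projection theorem (\<open>orth_proj_in\<close>), derived from
  completeness and the parallelogram law. The estimates are carried out in \<open>ennreal\<close>, where
  they remain valid for infinite constants because \<open>0 * top = 0\<close>.
\<close>

section \<open>Square roots and the Cauchy-Schwarz inequality for extended nonnegative reals\<close>

lemma ennsqrt_ennreal: "0 \<le> r \<Longrightarrow> ennsqrt (ennreal r) = ennreal (sqrt r)"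
  by (simp add: ennsqrt_def)

lemma ennsqrt_power2 [simp]: "(ennsqrt x)\<^sup>2 = x"
  by (cases x) (simp_all add: ennsqrt_def ennreal_power power2_eq_square ennreal_top_mult
      flip: ennreal_mult)

lemma ennsqrt_of_power2 [simp]: "ennsqrt (x\<^sup>2) = x"
  by (cases x) (simp_all add: ennsqrt_ennreal ennreal_power, simp add: ennsqrt_def power2_eq_square ennreal_top_mult)

lemma ennsqrt_mono: "x \<le> y \<Longrightarrow> ennsqrt x \<le> ennsqrt y"
  by (cases x; cases y) (auto simp: ennsqrt_ennreal, auto simp: ennsqrt_def top_unique)

lemma power2_le_imp_le_ennreal:
  fixes x y :: ennreal
  assumes "x\<^sup>2 \<le> y\<^sup>2"
  shows "x \<le> y"
  using ennsqrt_mono[OF assms] by simp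

lemma Cauchy_Schwarz_sum_ennreal:
  fixes x y :: "'i \<Rightarrow> ennreal"
  assumes "finite I"
  shows "(\<Sum>i\<in>I. x i * y i) \<le> ennsqrt (\<Sum>i\<in>I. (x i)\<^sup>2) * ennsqrt (\<Sum>i\<in>I. (y i)\<^sup>2)"
proof (rule power2_le_imp_le_ennreal)
  have "(\<Sum>i\<in>I. x i * y i)\<^sup>2 \<le> (\<Sum>i\<in>I. (x i)\<^sup>2) * (\<Sum>i\<in>I. (y i)\<^sup>2)"
    using Cauchy_Schwarz_nn_integral[of x "count_space I" y] assms
    by (simp add: nn_integral_count_space_finite)
  then show "(\<Sum>i\<in>I. x i * y i)\<^sup>2
      \<le> (ennsqrt (\<Sum>i\<in>I. (x i)\<^sup>2) * ennsqrt (\<Sum>i\<in>I. (y i)\<^sup>2))\<^sup>2"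
    by (simp add: power_mult_distrib)
qed

lemma le_SUP_quotient:
  fixes g :: "'v::real_normed_vector \<Rightarrow> real"
  assumes "x \<in> A" "x = 0 \<Longrightarrow> g x = 0"
  shows "ennreal (g x) \<le> (SUP v\<in>A - {0}. ennreal (g v / norm v)) * ennreal (norm x)"
proof (cases "x = 0")
  case False
  then have "ennreal (g x) = ennreal (g x / norm x) * ennreal (norm x)"
    by (simp add: ennreal_mult''[symmetric])
  also have "\<dots> \<le> (SUP v\<in>A - {0}. ennreal (g v / norm v)) * ennreal (norm x)"
    using False assms(1) by (intro mult_right_mono SUP_upper) auto
  finally show ?thesis .
qed (use assms(2) in simp)


section \<open>Conjugation and antilinear functionals\<close>

lemma kcnj_zero [simp]: "kcnj (0 :: 'k::real_or_complex) = 0"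
  using kcnj_scaleR[of 0 "0 :: 'k"] by simp

lemma kcnj_one [simp]: "kcnj (1 :: 'k::real_or_complex) = 1"
  using mult_kcnj[of "1 :: 'k"] by simp

lemma kcnj_of_real [simp]: "kcnj (of_real r :: 'k::real_or_complex) = of_real r"
  by (simp add: of_real_def kcnj_scaleR)

lemma kcnj_mult_self: "kcnj x * x = of_real ((norm (x :: 'k::real_or_complex))\<^sup>2)"
  using mult_kcnj[of x] by (simp add: mult.commute of_real_def)

lemma antilinear_functional_zero:
  assumes "antilinear_functional smul F"
  shows "F 0 = 0"
proof -
  have "F (0 + 0) = F 0 + F 0"
    using assms unfolding antilinear_functional_def by blast
  then show ?thesis by simp
qed

lemma antilinear_functional_diff:
  assumes "antilinear_functional smul F"
  shows "F (v - w) = F v - F w"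
proof -
  have "F ((v - w) + w) = F (v - w) + F w"
    using assms unfolding antilinear_functional_def by blast
  then show ?thesis by simp
qed

lemma antilinear_functional_sum:
  assumes "antilinear_functional smul F"
  shows "F (\<Sum>i\<in>I. x i) = (\<Sum>i\<in>I. F (x i))"
  using assms antilinear_functional_zero[OF assms]
  by (induction I rule: infinite_finite_induct) (simp_all add: antilinear_functional_def)

lemma dual_norm_bound:
  assumes "antilinear_functional smul F" "x \<in> W"
  shows "ennreal (norm (F x)) \<le> dual_norm W F * ennreal (norm x)"
  unfolding dual_norm_def
  using assms antilinear_functional_zero[OF assms(1)]
  by (intro le_SUP_quotient[where g = "\<lambda>v. norm (F v)"]) auto

lemma dual_norm_le:
  assumes "\<And>v. ennreal (norm (F v)) \<le> g * ennreal (norm v)"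
  shows "dual_norm W F \<le> g"
  unfolding dual_norm_def
proof (rule SUP_least)
  fix v assume "v \<in> W - {0}"
  then have v: "ennreal (norm v) \<noteq> 0" "norm v > 0" by auto
  have "ennreal (norm (F v) / norm v) * ennreal (norm v) = ennreal (norm (F v))"
    using v by (simp add: ennreal_mult''[symmetric])
  then have "ennreal (norm v) * ennreal (norm (F v) / norm v) \<le> ennreal (norm v) * g"
    using assms[of v] by (simp add: mult.commute)
  then show "ennreal (norm (F v) / norm v) \<le> g"
    using v by (simp add: ennreal_mult_le_mult_iff)
qed

lemma sesquilinear_form_diff_left:
  assumes "sesquilinear_form smul a"
  shows "a (v - w) z = a v z - a w z"
proof -
  interpret Vector_Spaces.linear smul "(*)" "\<lambda>v. a v z"
    using assms by (simp add: sesquilinear_form_def)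
  show ?thesis by (rule diff)
qed

lemma sesquilinear_form_zero:
  assumes "sesquilinear_form smul a"
  shows "a 0 v = 0" "a v 0 = 0"
proof -
  show "a 0 v = 0"
    using sesquilinear_form_diff_left[OF assms, of 0 0] by simp
  have "antilinear_functional smul (a v)"
    using assms by (simp add: sesquilinear_form_def)
  then show "a v 0 = 0" by (rule antilinear_functional_zero)
qed

lemma continuity_const_bound:
  assumes "sesquilinear_form smul a"
  shows "ennreal (norm (a v w)) \<le> continuity_const a * ennreal (norm v) * ennreal (norm w)"
proof (cases "v = 0 \<or> w = 0")
  case True
  then show ?thesis using sesquilinear_form_zero[OF assms] by auto
next
  case False
  have "ennreal (norm (a v w) / (norm v * norm w)) \<le> continuity_const a"
    unfolding continuity_const_def using False
    by (intro SUP_upper2[of v] SUP_upper2[of w]) auto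
  from mult_right_mono[OF this, of "ennreal (norm v * norm w)"] show ?thesis
    using False by (simp add: ennreal_mult[symmetric] mult.assoc)
qed

text \<open>
  The constant is \<open>top\<close> only on the zero space, so the proof can cancel it for \<open>v \<noteq> 0\<close>.
\<close>

lemma norm_le_coercivity_const:
  assumes "0 < coercivity_const a" "ennreal (norm (a v v)) \<le> S * ennreal (norm v)"
  shows "ennreal (norm v) \<le> 1 / coercivity_const a * S"
proof (cases "v = 0")
  case False
  let ?\<alpha> = "coercivity_const a"
  let ?n = "ennreal (norm v)"
  have \<alpha>: "?\<alpha> \<le> ennreal (norm (a v v) / (norm v)\<^sup>2)"
    unfolding coercivity_const_def using False by (intro INF_lower) auto
  then have top: "?\<alpha> < top"
    using le_less_trans ennreal_less_top by blast
  have "?n * (?\<alpha> * ?n) = ?\<alpha> * ennreal ((norm v)\<^sup>2)"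
    by (simp add: power2_eq_square ennreal_mult mult_ac)
  also have "\<dots> \<le> ennreal (norm (a v v) / (norm v)\<^sup>2) * ennreal ((norm v)\<^sup>2)"
    using \<alpha> by (rule mult_right_mono) simp
  also have "\<dots> = ennreal (norm (a v v))"
    using False by (simp add: ennreal_mult[symmetric])
  also have "\<dots> \<le> ?n * S"
    using assms(2) by (simp add: mult.commute)
  finally have "?\<alpha> * ?n \<le> S"
    using False by (simp add: ennreal_mult_le_mult_iff)
  then have "1 / ?\<alpha> * (?\<alpha> * ?n) \<le> 1 / ?\<alpha> * S"
    by (rule mult_left_mono) simp
  moreover have "1 / ?\<alpha> * (?\<alpha> * ?n) = ?n"
    using assms(1) top
    by (simp add: mult.assoc[symmetric] ennreal_divide_times ennreal_divide_self)
  ultimately show ?thesis by simp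
qed simp


section \<open>The projection theorem\<close>

context hilbert_space
begin

lemma ip_diff_left: "ip (v - w) z = ip v z - ip w z"
  using ip_add_left[of "v - w" w z] by simp

lemma ip_add_right: "ip z (v + w) = ip z v + ip z w"
  unfolding ip_commute[of z "v + w"] ip_commute[of z v] ip_commute[of z w]
  by (simp add: ip_add_left kcnj_add)

lemma ip_diff_right: "ip z (v - w) = ip z v - ip z w"
  using ip_add_right[of z "v - w" w] by simp

lemma ip_scale_right: "ip v (smul c w) = kcnj c * ip v w"
  unfolding ip_commute[of v "smul c w"] ip_commute[of v w]
  by (simp add: ip_scale_left kcnj_mult)

lemma ip_zero_right [simp]: "ip v 0 = 0"
  using ip_diff_right[of v 0 0] by simp

lemma ip_sum_right: "ip v (\<Sum>i\<in>I. x i) = (\<Sum>i\<in>I. ip v (x i))"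
  by (induction I rule: infinite_finite_induct) (simp_all add: ip_add_right)

lemma norm_power2_eqI:
  assumes "ip v v = of_real r"
  shows "(norm v)\<^sup>2 = r"
proof -
  have "(of_real ((norm v)\<^sup>2) :: 'k) = of_real r"
    using assms by (simp only: ip_self)
  then show ?thesis by (simp only: of_real_eq_iff)
qed

lemma parallelogram:
  fixes v w :: 'v
  shows "(norm (v + w))\<^sup>2 + (norm (v - w))\<^sup>2 = 2 * (norm v)\<^sup>2 + 2 * (norm w)\<^sup>2"
proof -
  have "ip (v + w) (v + w) + ip (v - w) (v - w) = 2 * ip v v + 2 * ip w w"
    by (simp add: ip_add_left ip_add_right ip_diff_left ip_diff_right)
  then have "(of_real ((norm (v + w))\<^sup>2 + (norm (v - w))\<^sup>2) :: 'k) =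
      of_real (2 * (norm v)\<^sup>2 + 2 * (norm w)\<^sup>2)"
    by (simp add: ip_self)
  then show ?thesis by (simp only: of_real_eq_iff)
qed

lemma pythagoras_sum:
  assumes "finite I" "\<And>i j. i \<in> I \<Longrightarrow> j \<in> I \<Longrightarrow> i \<noteq> j \<Longrightarrow> ip (x i) (x j) = 0"
  shows "(norm (\<Sum>i\<in>I. x i :: 'v))\<^sup>2 = (\<Sum>i\<in>I. (norm (x i))\<^sup>2)"
  using assms
proof (induction I rule: finite_induct)
  case (insert k I)
  let ?s = "\<Sum>i\<in>I. x i"
  have 0: "ip (x k) ?s = 0"
    using insert.prems insert.hyps by (auto simp: ip_sum_right intro!: sum.neutral)
  then have "ip ?s (x k) = 0"
    using ip_commute[of ?s "x k"] by simp
  with 0 have "ip (x k + ?s) (x k + ?s) = of_real ((norm (x k))\<^sup>2 + (norm ?s)\<^sup>2)"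
    unfolding ip_add_left ip_add_right by (simp add: ip_self)
  from norm_power2_eqI[OF this] show ?case
    using insert by simp
qed simp

lemma subspace_scaleR:
  "module.subspace smul W \<Longrightarrow> v \<in> W \<Longrightarrow> r *\<^sub>R v \<in> W"
  using local.subspace_scale[of W v "of_real r"] by (simp add: scale_of_real)

text \<open>
  Subtracting \<open>(ip z w / \<parallel>w\<parallel>\<^sup>2) w\<close> from a vector \<open>z\<close> with \<open>ip z w \<noteq> 0\<close> would shorten it.
\<close>

lemma ip_eq_zero_if_norm_minimal:
  assumes W: "module.subspace smul W" "w \<in> W"
    and min: "\<And>w. w \<in> W \<Longrightarrow> norm z \<le> norm (z - w)"
  shows "ip z w = 0"
proof (cases "w = 0")
  case False
  define c where "c = of_real (1 / (norm w)\<^sup>2) * ip z w"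
  define t where "t = (norm (ip z w))\<^sup>2 / (norm w)\<^sup>2"
  have kc: "kcnj c = of_real (1 / (norm w)\<^sup>2) * kcnj (ip z w)"
    unfolding c_def kcnj_mult kcnj_of_real ..
  have 1: "kcnj c * ip z w = of_real t"
    unfolding kc t_def using kcnj_mult_self[of "ip z w"] by (simp add: mult.assoc)
  have 2: "c * ip w z = of_real t"
    unfolding c_def t_def ip_commute[of w z]
    using kcnj_mult_self[of "ip z w"] by (simp add: mult.assoc mult.commute)
  have 3: "c * (kcnj c * ip w w) = of_real t"
  proof -
    have "c * (kcnj c * ip w w) = kcnj c * (c * ip w w)" by (simp add: mult_ac)
    also have "c * ip w w = ip z w"
      using False by (simp add: c_def ip_self)
    finally show ?thesis using 1 by simp
  qed
  have "ip (z - smul c w) (z - smul c w)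
      = ip z z - kcnj c * ip z w - c * ip w z + c * (kcnj c * ip w w)"
    unfolding ip_diff_left ip_diff_right ip_scale_left ip_scale_right
    by (simp add: algebra_simps)
  also have "\<dots> = of_real ((norm z)\<^sup>2 - t)"
    unfolding 1 2 3 by (simp add: ip_self)
  finally have "(norm (z - smul c w))\<^sup>2 = (norm z)\<^sup>2 - t"
    by (rule norm_power2_eqI)
  moreover have "norm z \<le> norm (z - smul c w)"
    using W by (intro min local.subspace_scale)
  then have "(norm z)\<^sup>2 \<le> (norm (z - smul c w))\<^sup>2"
    by (intro power_mono) auto
  ultimately have "t \<le> 0" by simp
  then show ?thesis
    using False by (simp add: t_def divide_le_0_iff)
qed simp

text \<open>
  By the parallelogram law, any minimizing sequence for the distance from \<open>v\<close> to \<open>W\<close> is a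
  Cauchy sequence.
\<close>

lemma nearest_point_exists:
  assumes W: "module.subspace smul W" "closed W"
  obtains p where "p \<in> W" "\<And>w. w \<in> W \<Longrightarrow> norm (v - p) \<le> norm (v - w)"
proof -
  define m where "m = (INF w\<in>W. norm (v - w))"
  have ne: "W \<noteq> {}" using local.subspace_0[OF W(1)] by auto
  have bdd: "bdd_below ((\<lambda>w. norm (v - w)) ` W)"
    by (intro bdd_belowI[where m = 0]) auto
  have m_le: "m \<le> norm (v - w)" if "w \<in> W" for w
    unfolding m_def using that bdd by (intro cINF_lower)
  have m0: "0 \<le> m"
    unfolding m_def using ne by (intro cINF_greatest) auto
  have "\<exists>w\<in>W. norm (v - w) < m + inverse (real (Suc n))" for n
    using cInf_lessD[of "(\<lambda>w. norm (v - w)) ` W" "m + inverse (real (Suc n))"] ne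
    by (auto simp: m_def)
  then obtain x where x: "\<And>n. x n \<in> W" "\<And>n. norm (v - x n) < m + inverse (real (Suc n))"
    by metis
  have lim: "(\<lambda>n. norm (v - x n)) \<longlonglongrightarrow> m"
  proof (rule tendsto_sandwich[where f = "\<lambda>_. m"])
    show "(\<lambda>n. m + inverse (real (Suc n))) \<longlonglongrightarrow> m"
      using tendsto_add[OF tendsto_const LIMSEQ_inverse_real_of_nat, of m] by simp
  qed (use x m_le in \<open>auto intro!: always_eventually less_imp_le simp del: of_nat_Suc\<close>)
  have gap: "(norm (x i - x j))\<^sup>2 \<le> 2 * ((norm (v - x i))\<^sup>2 - m\<^sup>2) + 2 * ((norm (v - x j))\<^sup>2 - m\<^sup>2)"
    for i j
  proof -
    \<comment> \<open>the midpoint of \<open>x i\<close> and \<open>x j\<close> lies in \<open>W\<close>\<close>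
    have "(1/2) *\<^sub>R (x i + x j) \<in> W"
      using W x by (intro subspace_scaleR local.subspace_add)
    then have "m \<le> norm (v - (1/2) *\<^sub>R (x i + x j))"
      by (rule m_le)
    also have "v - (1/2) *\<^sub>R (x i + x j) = (1/2) *\<^sub>R ((v - x i) + (v - x j))"
      using scaleR_half_double[of v]
      by (simp only: add_diff_add[symmetric] scaleR_diff_right)
    finally have "2 * m \<le> norm ((v - x i) + (v - x j))" by simp
    then have "(2 * m)\<^sup>2 \<le> (norm ((v - x i) + (v - x j)))\<^sup>2"
      using m0 by (intro power_mono) auto
    moreover have "norm ((v - x i) - (v - x j)) = norm (x i - x j)"
      by (simp add: norm_minus_commute)
    ultimately show ?thesis
      using parallelogram[of "v - x i" "v - x j"] by (simp add: power_mult_distrib)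
  qed
  have "(\<lambda>n. (norm (v - x n))\<^sup>2 - m\<^sup>2) \<longlonglongrightarrow> m\<^sup>2 - m\<^sup>2"
    by (intro tendsto_intros lim)
  then have excess: "(\<lambda>n. (norm (v - x n))\<^sup>2 - m\<^sup>2) \<longlonglongrightarrow> 0"
    by simp
  have "Cauchy x"
  proof (rule CauchyI)
    fix \<epsilon> :: real
    assume \<epsilon>: "0 < \<epsilon>"
    then have "\<forall>\<^sub>F n in sequentially. (norm (v - x n))\<^sup>2 - m\<^sup>2 < \<epsilon>\<^sup>2 / 4"
      using order_tendstoD(2)[OF excess, of "\<epsilon>\<^sup>2 / 4"] by simp
    then obtain K where K: "\<And>n. n \<ge> K \<Longrightarrow> (norm (v - x n))\<^sup>2 - m\<^sup>2 < \<epsilon>\<^sup>2 / 4"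
      by (auto simp: eventually_sequentially)
    have "norm (x i - x j) < \<epsilon>" if "i \<ge> K" "j \<ge> K" for i j
    proof (rule power2_less_imp_less)
      show "(norm (x i - x j))\<^sup>2 < \<epsilon>\<^sup>2"
        using gap[of i j] K[OF that(1)] K[OF that(2)] by argo
    qed (use \<epsilon> in simp)
    then show "\<exists>K. \<forall>i\<ge>K. \<forall>j\<ge>K. norm (x i - x j) < \<epsilon>" by blast
  qed
  then obtain p where p: "x \<longlonglongrightarrow> p"
    using Cauchy_convergent convergent_def by blast
  show thesis
  proof
    show "p \<in> W" using W(2) x(1) p by (rule closed_sequentially)
    have "(\<lambda>n. norm (v - x n)) \<longlonglongrightarrow> norm (v - p)"
      by (intro tendsto_intros p)
    with lim have "norm (v - p) = m" by (metis LIMSEQ_unique)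
    then show "norm (v - p) \<le> norm (v - w)" if "w \<in> W" for w
      using m_le[OF that] by simp
  qed
qed

lemma orth_proj_in:
  assumes W: "module.subspace smul W" "closed W"
  shows "orth_proj ip W v \<in> W"
proof -
  obtain p where p: "p \<in> W" "\<And>w. w \<in> W \<Longrightarrow> norm (v - p) \<le> norm (v - w)"
    using nearest_point_exists[OF W] by blast
  have orth: "ip (v - p) w = 0" if "w \<in> W" for w
  proof (rule ip_eq_zero_if_norm_minimal[OF W(1) that])
    fix w' assume "w' \<in> W"
    then show "norm (v - p) \<le> norm (v - p - w')"
      using p(2)[of "p + w'"] local.subspace_add[OF W(1) p(1)] by (simp add: diff_diff_eq)
  qed
  have "q = p" if q: "q \<in> W" "\<And>w. w \<in> W \<Longrightarrow> ip (v - q) w = 0" for q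
  proof -
    have "p - q \<in> W" using W(1) p(1) q(1) by (rule local.subspace_diff)
    then have "ip (v - q) (p - q) - ip (v - p) (p - q) = 0"
      using q(2) orth by simp
    then have "ip (p - q) (p - q) = of_real 0"
      by (simp add: ip_diff_left)
    from norm_power2_eqI[OF this] show ?thesis by simp
  qed
  then have "orth_proj ip W v = p"
    unfolding orth_proj_def using p(1) orth by (intro the_equality) blast+
  then show ?thesis using p(1) by simp
qed


section \<open>Dual norms on mutually orthogonal subspaces\<close>

text \<open>
  The functional is tested with \<open>\<Sum>i. smul (F (x i)) (x i)\<close>, whose squared norm is at most
  \<open>\<Sum>i. \<parallel>F (x i)\<parallel>\<^sup>2\<close>, the value of \<open>F\<close> on it.
\<close>

lemma sum_orthogonal_values_le:
  assumes "finite I"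
    and orth: "\<And>i j. i \<in> I \<Longrightarrow> j \<in> I \<Longrightarrow> i \<noteq> j \<Longrightarrow> ip (x i) (x j) = 0"
    and x: "\<And>i. i \<in> I \<Longrightarrow> norm (x i) \<le> 1"
    and F: "antilinear_functional smul F"
    and G: "\<And>v. norm (F v) \<le> G * norm v"
  shows "(\<Sum>i\<in>I. (norm (F (x i)))\<^sup>2) \<le> G\<^sup>2"
proof -
  define y where "y i = smul (F (x i)) (x i)" for i
  define S where "S = (\<Sum>i\<in>I. (norm (F (x i)))\<^sup>2)"
  have S0: "0 \<le> S" unfolding S_def by (intro sum_nonneg) simp
  have norm_y: "(norm (y i))\<^sup>2 = (norm (F (x i)))\<^sup>2 * (norm (x i))\<^sup>2" for i
  proof (rule norm_power2_eqI)
    have "ip (y i) (y i) = (kcnj (F (x i)) * F (x i)) * ip (x i) (x i)"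
      by (simp add: y_def ip_scale_left ip_scale_right mult_ac)
    then show "ip (y i) (y i) = of_real ((norm (F (x i)))\<^sup>2 * (norm (x i))\<^sup>2)"
      by (simp add: kcnj_mult_self ip_self)
  qed
  have "F (\<Sum>i\<in>I. y i) = (\<Sum>i\<in>I. kcnj (F (x i)) * F (x i))"
    using F by (simp add: antilinear_functional_sum[OF F] y_def antilinear_functional_def)
  also have "\<dots> = of_real S"
    by (simp add: kcnj_mult_self S_def)
  finally have FS: "norm (F (\<Sum>i\<in>I. y i)) = S"
    using S0 by simp
  have "(norm (\<Sum>i\<in>I. y i))\<^sup>2 = (\<Sum>i\<in>I. (norm (y i))\<^sup>2)"
    using assms(1) orth
    by (intro pythagoras_sum) (simp_all add: y_def ip_scale_left ip_scale_right)
  also have "\<dots> \<le> S"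
    unfolding S_def norm_y using x by (intro sum_mono mult_left_le power_le_one) auto
  finally have nS: "(norm (\<Sum>i\<in>I. y i))\<^sup>2 \<le> S" .
  have "S\<^sup>2 \<le> (G * norm (\<Sum>i\<in>I. y i))\<^sup>2"
    using G[of "\<Sum>i\<in>I. y i"] S0 unfolding FS by (intro power_mono) auto
  also have "\<dots> \<le> G\<^sup>2 * S"
    using nS by (simp add: power_mult_distrib mult_left_mono)
  finally have "S * S \<le> G\<^sup>2 * S" by (simp add: power2_eq_square)
  then show ?thesis
    using S0 unfolding S_def[symmetric]
    by (cases "S = 0") (auto simp: mult_le_cancel_right)
qed

text \<open>
  The suprema defining the dual norms need not be attained, so each of them is approximated
  up to a factor \<open>\<delta> < 1\<close> by a value at a vector of norm at most 1.
\<close>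

lemma sum_dual_norm_le:
  assumes I: "finite I"
    and W: "\<And>i. i \<in> I \<Longrightarrow> module.subspace smul (W i)"
    and orth: "\<And>i j. i \<in> I \<Longrightarrow> j \<in> I \<Longrightarrow> i \<noteq> j \<Longrightarrow> orth_sets ip (W i) (W j)"
    and F: "antilinear_functional smul F"
    and g: "\<And>v. ennreal (norm (F v)) \<le> g * ennreal (norm v)"
  shows "(\<Sum>i\<in>I. (dual_norm (W i) F)\<^sup>2) \<le> g\<^sup>2"
proof (cases g)
  case top
  then show ?thesis by (simp add: power2_eq_square ennreal_top_mult)
next
  case (real G)
  have G: "norm (F v) \<le> G * norm v" for v
    using g[of v] real by (simp flip: ennreal_mult)
  define d where "d i = enn2real (dual_norm (W i) F)" for i
  have d: "dual_norm (W i) F = ennreal (d i)" for i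
    using dual_norm_le[OF g, of "W i"] real unfolding d_def
    by (intro ennreal_enn2real[symmetric]) (auto simp: top_unique intro: le_less_trans)
  have d0: "0 \<le> d i" for i by (simp add: d_def)
  have approx: "\<exists>x\<in>W i. norm x \<le> 1 \<and> \<delta> * d i \<le> norm (F x)"
    if i: "i \<in> I" and \<delta>: "0 < \<delta>" "\<delta> < 1" for i \<delta>
  proof (cases "d i = 0")
    case True
    then show ?thesis using local.subspace_0[OF W[OF i]] by (intro bexI[of _ 0]) auto
  next
    case False
    then have "\<delta> * d i < d i" using d0[of i] \<delta> by simp
    then have "ennreal (\<delta> * d i) < dual_norm (W i) F"
      using d0[of i] \<delta> by (simp add: d ennreal_less_iff)
    then obtain v where v: "v \<in> W i" "v \<noteq> 0" "ennreal (\<delta> * d i) < ennreal (norm (F v) / norm v)"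
      unfolding dual_norm_def less_SUP_iff by auto
    then have "\<delta> * d i < norm (F v) / norm v"
      using d0[of i] \<delta> by (simp add: ennreal_less_iff)
    moreover have "norm (F ((1 / norm v) *\<^sub>R v)) = norm (F v) / norm v"
    proof -
      have "F ((1 / norm v) *\<^sub>R v) = of_real (1 / norm v) * F v"
        using F unfolding antilinear_functional_def
        by (simp flip: scale_of_real del: of_real_divide)
      then show ?thesis by (simp add: norm_mult norm_divide)
    qed
    ultimately show ?thesis
      using v(2) subspace_scaleR[OF W[OF i] v(1), of "1 / norm v"]
      by (intro bexI[of _ "(1 / norm v) *\<^sub>R v"]) auto
  qed
  have "\<delta> * (\<Sum>i\<in>I. (d i)\<^sup>2) \<le> G\<^sup>2" if \<delta>: "0 < \<delta>" "\<delta> < 1" for \<delta>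
  proof -
    \<comment> \<open>the approximation is squared, hence the root\<close>
    let ?\<delta> = "sqrt \<delta>"
    have "0 < ?\<delta>" "?\<delta> < 1" using \<delta> by auto
    from approx[OF _ this] obtain x where
      x: "\<And>i. i \<in> I \<Longrightarrow> x i \<in> W i" "\<And>i. i \<in> I \<Longrightarrow> norm (x i) \<le> 1"
         "\<And>i. i \<in> I \<Longrightarrow> ?\<delta> * d i \<le> norm (F (x i))"
      by metis
    have "\<delta> * (\<Sum>i\<in>I. (d i)\<^sup>2) = (\<Sum>i\<in>I. (?\<delta> * d i)\<^sup>2)"
      using \<delta> by (simp add: sum_distrib_left power_mult_distrib)
    also have "\<dots> \<le> (\<Sum>i\<in>I. (norm (F (x i)))\<^sup>2)"
      using x(3) d0 \<delta> by (intro sum_mono power_mono) auto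
    also have "\<dots> \<le> G\<^sup>2"
      using I x(1,2) orth F G
      by (intro sum_orthogonal_values_le) (auto simp: orth_sets_def)
    finally show ?thesis .
  qed
  then have "(\<Sum>i\<in>I. (d i)\<^sup>2) \<le> G\<^sup>2"
    by (rule field_le_mult_one_interval)
  then show ?thesis
    using real d0 by (simp add: d ennreal_power sum_ennreal)
qed

lemma sum_dual_norm_partition_le:
  assumes I: "finite I" "partition_on I \<J>"
    and W: "\<And>i. i \<in> I \<Longrightarrow> module.subspace smul (W i)"
    and orth: "\<And>J i j. J \<in> \<J> \<Longrightarrow> i \<in> J \<Longrightarrow> j \<in> J \<Longrightarrow> i \<noteq> j \<Longrightarrow> orth_sets ip (W i) (W j)"
    and F: "antilinear_functional smul F"
    and g: "\<And>v. ennreal (norm (F v)) \<le> g * ennreal (norm v)"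
  shows "ennsqrt (\<Sum>i\<in>I. (dual_norm (W i) F)\<^sup>2) \<le> ennsqrt (of_nat (card \<J>)) * g"
proof (rule power2_le_imp_le_ennreal)
  have U: "\<Union>\<J> = I" and dj: "disjoint \<J>"
    using I(2) by (auto simp: partition_on_def)
  have fin: "finite J" if "J \<in> \<J>" for J
    using that U I(1) by (meson Union_upper finite_subset)
  have "(\<Sum>i\<in>I. (dual_norm (W i) F)\<^sup>2) = (\<Sum>J\<in>\<J>. \<Sum>i\<in>J. (dual_norm (W i) F)\<^sup>2)"
    unfolding U[symmetric] using fin dj
    by (subst sum.Union_disjoint) (auto simp: disjoint_def)
  also have "\<dots> \<le> (\<Sum>J\<in>\<J>. g\<^sup>2)"
    using fin U W orth F g by (intro sum_mono sum_dual_norm_le) auto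
  finally show "(ennsqrt (\<Sum>i\<in>I. (dual_norm (W i) F)\<^sup>2))\<^sup>2 \<le> (ennsqrt (of_nat (card \<J>)) * g)\<^sup>2"
    by (simp add: power_mult_distrib)
qed

end


section \<open>Reliability and efficiency of the localized estimators\<close>

theorem corollary4p2p4:
  fixes smul :: "'k::real_or_complex \<Rightarrow> 'v::banach \<Rightarrow> 'v"
    and ip :: "'v \<Rightarrow> 'v \<Rightarrow> 'k"
    and smulE :: "'k \<Rightarrow> 'e::ab_group_add \<Rightarrow> 'e"
    and \<Omega> :: "(real ^ 'd) set"
    and M :: "(real ^ 'd) measure"
    and fn :: "'v \<Rightarrow> real ^ 'd \<Rightarrow> 'e"
    and N :: nat
    and \<omega> :: "nat \<Rightarrow> (real ^ 'd) set"
    and Vs :: "nat \<Rightarrow> 'v set"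
    and P :: "nat \<Rightarrow> 'v \<Rightarrow> 'v"
    and Vt :: "'v set"
    and \<J> :: "nat set set"
    and D :: "'p set"
    and a :: "'p \<Rightarrow> 'v \<Rightarrow> 'v \<Rightarrow> 'k"
    and f :: "'p \<Rightarrow> 'v \<Rightarrow> 'k"
    and u ut :: "'p \<Rightarrow> 'v"
  assumes "localizing_space_decomposition smul ip smulE \<Omega> M fn N \<omega> Vs P"
    and "partition_on {1..N} \<J>"
    and "\<And>J i j. J \<in> \<J> \<Longrightarrow> i \<in> J \<Longrightarrow> j \<in> J \<Longrightarrow> i \<noteq> j \<Longrightarrow> orth_sets ip (Vs i) (Vs j)"
    and "module.subspace smul Vt"
    and "\<And>i. i \<in> {1..N} \<Longrightarrow> closed (Vt \<inter> Vs i)"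
    and "\<And>\<mu>. \<mu> \<in> D \<Longrightarrow> sesquilinear_form smul (a \<mu>)"
    and "\<And>\<mu>. \<mu> \<in> D \<Longrightarrow> continuous_on UNIV (\<lambda>(v, w). a \<mu> v w)"
    and "\<And>\<mu>. \<mu> \<in> D \<Longrightarrow> coercivity_const (a \<mu>) > 0"
    and "\<And>\<mu>. \<mu> \<in> D \<Longrightarrow> antilinear_functional smul (f \<mu>)"
    and "\<And>\<mu>. \<mu> \<in> D \<Longrightarrow> continuous_on UNIV (f \<mu>)"
    and "\<And>\<mu> v. \<mu> \<in> D \<Longrightarrow> a \<mu> (u \<mu>) v = f \<mu> v"
    and "\<And>\<mu>. \<mu> \<in> D \<Longrightarrow> ut \<mu> \<in> Vt"
    and "\<And>\<mu> v. \<mu> \<in> D \<Longrightarrow> v \<in> Vt \<Longrightarrow> a \<mu> (ut \<mu>) v = f \<mu> v"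
  shows "\<forall>\<mu>\<in>D.
      ennreal (norm (u \<mu> - ut \<mu>)) \<le> Delta_loc_l ip N Vs P Vt (a \<mu>) (f \<mu>) (ut \<mu>) \<and>
      Delta_loc_l ip N Vs P Vt (a \<mu>) (f \<mu>) (ut \<mu>) \<le>
        continuity_const (a \<mu>) / coercivity_const (a \<mu>) *
        ennsqrt (\<Sum>i\<in>{1..N}. (loc_const ip Vs P Vt i)\<^sup>2) *
        ennsqrt (of_nat (card \<J>)) * ennreal (norm (u \<mu> - ut \<mu>)) \<and>
      ennreal (norm (u \<mu> - ut \<mu>)) \<le> Delta_loc_g ip N Vs P Vt (a \<mu>) (f \<mu>) (ut \<mu>) \<and>
      Delta_loc_g ip N Vs P Vt (a \<mu>) (f \<mu>) (ut \<mu>) \<le>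
        continuity_const (a \<mu>) / coercivity_const (a \<mu>) *
        pu_const ip N Vs P Vt *
        ennsqrt (of_nat (card \<J>)) * ennreal (norm (u \<mu> - ut \<mu>))"
proof (intro ballI)
  fix \<mu> assume \<mu>: "\<mu> \<in> D"
  interpret localizing_space_decomposition smul ip smulE \<Omega> M fn N \<omega> Vs P by (rule assms(1))
  let ?I = "{1..N}"
  let ?\<alpha> = "coercivity_const (a \<mu>)" and ?\<gamma> = "continuity_const (a \<mu>)"
  let ?c = "loc_const ip Vs P Vt" and ?cpu = "pu_const ip N Vs P Vt"
  define e where "e = u \<mu> - ut \<mu>"
  define R where "R = residual (a \<mu>) (f \<mu>) (ut \<mu>)"
  define r where "r i = dual_norm (Vs i) R" for i
  define Q where "Q i = orth_proj ip (Vt \<inter> Vs i)" for i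
  define z where "z i = P i e - Q i (P i e)" for i
  note sesq = assms(6)[OF \<mu>]
  have R: "R = a \<mu> e"
    using assms(11)[OF \<mu>] sesquilinear_form_diff_left[OF sesq]
    by (auto simp: R_def residual_def e_def fun_eq_iff)
  have R_anti: "antilinear_functional smul R"
    using sesq by (simp add: R sesquilinear_form_def)
  have R_Vt: "R v = 0" if "v \<in> Vt" for v
    using assms(13)[OF \<mu> that] by (simp add: R_def residual_def)
  have Q_in: "Q i v \<in> Vt \<inter> Vs i" if "i \<in> ?I" for i v
    unfolding Q_def using assms(4,5) local_subspace that
    by (intro orth_proj_in local.subspace_inter)
  have z_in: "z i \<in> Vs i" if "i \<in> ?I" for i
    unfolding z_def using Q_in[OF that] map_range[OF that] local_subspace[OF that]
    by (intro local.subspace_diff) auto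
  have Re: "norm (R e) \<le> (\<Sum>i\<in>?I. norm (R (z i)))"
  proof -
    have "R e = (\<Sum>i\<in>?I. R (P i e))"
      using map_sum[of e] antilinear_functional_sum[OF R_anti, of "\<lambda>i. P i e" ?I] by simp
    also have "\<dots> = (\<Sum>i\<in>?I. R (z i))"
      using R_Vt Q_in
      by (intro sum.cong) (auto simp: z_def antilinear_functional_diff[OF R_anti])
    finally show ?thesis by (simp add: norm_sum)
  qed
  have Rz: "ennreal (norm (R e)) \<le> (\<Sum>i\<in>?I. r i * ennreal (norm (z i)))"
  proof -
    have "ennreal (norm (R e)) \<le> (\<Sum>i\<in>?I. ennreal (norm (R (z i))))"
      using Re by (simp add: sum_ennreal ennreal_leI)
    also have "\<dots> \<le> (\<Sum>i\<in>?I. r i * ennreal (norm (z i)))"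
      unfolding r_def using z_in by (intro sum_mono dual_norm_bound[OF R_anti])
    finally show ?thesis .
  qed
  \<comment> \<open>the suprema in the constants only involve nonzero vectors, whence the case distinctions\<close>
  have rel_l: "ennreal (norm e) \<le> 1 / ?\<alpha> * (\<Sum>i\<in>?I. ?c i * r i)"
  proof (cases "e = 0")
    case False
    have "ennreal (norm (z i)) \<le> ?c i * ennreal (norm e)" for i
      using le_SUP_quotient[of e UNIV "\<lambda>v. norm (P i v - Q i (P i v))"] False
      by (simp add: loc_const_def Q_def z_def)
    then have "(\<Sum>i\<in>?I. r i * ennreal (norm (z i))) \<le> (\<Sum>i\<in>?I. r i * (?c i * ennreal (norm e)))"
      by (intro sum_mono mult_left_mono) auto
    with Rz have "ennreal (norm (R e)) \<le> (\<Sum>i\<in>?I. r i * (?c i * ennreal (norm e)))"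
      by (rule order_trans)
    then have "ennreal (norm (a \<mu> e e)) \<le> (\<Sum>i\<in>?I. ?c i * r i) * ennreal (norm e)"
      unfolding R sum_distrib_right by (simp only: mult_ac)
    then show ?thesis by (rule norm_le_coercivity_const[OF assms(8)[OF \<mu>]])
  qed simp
  have rel_g: "ennreal (norm e) \<le> 1 / ?\<alpha> * (?cpu * ennsqrt (\<Sum>i\<in>?I. (r i)\<^sup>2))"
  proof (cases "e = 0")
    case False
    have "ennsqrt (\<Sum>i\<in>?I. (ennreal (norm (z i)))\<^sup>2) = ennreal (sqrt (\<Sum>i\<in>?I. (norm (z i))\<^sup>2))"
      by (simp add: ennreal_power sum_ennreal ennsqrt_ennreal sum_nonneg)
    also have "\<dots> \<le> ?cpu * ennreal (norm e)"
      using le_SUP_quotient[of e UNIV "\<lambda>v. sqrt (\<Sum>i\<in>?I. (norm (P i v - Q i (P i v)))\<^sup>2)"] False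
      by (simp add: pu_const_def Q_def z_def)
    finally have "ennsqrt (\<Sum>i\<in>?I. (r i)\<^sup>2) * ennsqrt (\<Sum>i\<in>?I. (ennreal (norm (z i)))\<^sup>2)
        \<le> ennsqrt (\<Sum>i\<in>?I. (r i)\<^sup>2) * (?cpu * ennreal (norm e))"
      by (rule mult_left_mono) simp
    with Rz Cauchy_Schwarz_sum_ennreal[of ?I r "\<lambda>i. ennreal (norm (z i))"]
    have "ennreal (norm (R e)) \<le> ennsqrt (\<Sum>i\<in>?I. (r i)\<^sup>2) * (?cpu * ennreal (norm e))"
      by (meson finite_atLeastAtMost order_trans)
    then have "ennreal (norm (a \<mu> e e)) \<le> ?cpu * ennsqrt (\<Sum>i\<in>?I. (r i)\<^sup>2) * ennreal (norm e)"
      by (simp add: R mult_ac)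
    then show ?thesis by (rule norm_le_coercivity_const[OF assms(8)[OF \<mu>]])
  qed simp
  have eff: "ennsqrt (\<Sum>i\<in>?I. (r i)\<^sup>2) \<le> ennsqrt (of_nat (card \<J>)) * (?\<gamma> * ennreal (norm e))"
    unfolding r_def using assms(2,3) local_subspace R_anti continuity_const_bound[OF sesq, of e]
    by (intro sum_dual_norm_partition_le) (auto simp: R)
  have "1 / ?\<alpha> * (\<Sum>i\<in>?I. ?c i * r i)
      \<le> 1 / ?\<alpha> * (ennsqrt (\<Sum>i\<in>?I. (?c i)\<^sup>2) * ennsqrt (\<Sum>i\<in>?I. (r i)\<^sup>2))"
    by (intro mult_left_mono Cauchy_Schwarz_sum_ennreal) auto
  also have "\<dots> \<le> 1 / ?\<alpha> * (ennsqrt (\<Sum>i\<in>?I. (?c i)\<^sup>2)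
      * (ennsqrt (of_nat (card \<J>)) * (?\<gamma> * ennreal (norm e))))"
    by (intro mult_left_mono eff) auto
  finally have eff_l: "1 / ?\<alpha> * (\<Sum>i\<in>?I. ?c i * r i)
      \<le> ?\<gamma> / ?\<alpha> * ennsqrt (\<Sum>i\<in>?I. (?c i)\<^sup>2) * ennsqrt (of_nat (card \<J>)) * ennreal (norm e)"
    by (simp add: divide_ennreal_def mult_ac)
  have "1 / ?\<alpha> * (?cpu * ennsqrt (\<Sum>i\<in>?I. (r i)\<^sup>2))
      \<le> 1 / ?\<alpha> * (?cpu * (ennsqrt (of_nat (card \<J>)) * (?\<gamma> * ennreal (norm e))))"
    by (intro mult_left_mono eff) auto
  then have eff_g: "1 / ?\<alpha> * (?cpu * ennsqrt (\<Sum>i\<in>?I. (r i)\<^sup>2))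
      \<le> ?\<gamma> / ?\<alpha> * ?cpu * ennsqrt (of_nat (card \<J>)) * ennreal (norm e)"
    by (simp add: divide_ennreal_def mult_ac)
  have "Delta_loc_l ip N Vs P Vt (a \<mu>) (f \<mu>) (ut \<mu>) = 1 / ?\<alpha> * (\<Sum>i\<in>?I. ?c i * r i)"
    "Delta_loc_g ip N Vs P Vt (a \<mu>) (f \<mu>) (ut \<mu>)
      = 1 / ?\<alpha> * (?cpu * ennsqrt (\<Sum>i\<in>?I. (r i)\<^sup>2))"
    by (simp_all add: Delta_loc_l_def Delta_loc_g_def r_def R_def mult.assoc)
  then show "ennreal (norm (u \<mu> - ut \<mu>)) \<le> Delta_loc_l ip N Vs P Vt (a \<mu>) (f \<mu>) (ut \<mu>) \<and>
      Delta_loc_l ip N Vs P Vt (a \<mu>) (f \<mu>) (ut \<mu>) \<le>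
        ?\<gamma> / ?\<alpha> * ennsqrt (\<Sum>i\<in>?I. (?c i)\<^sup>2) * ennsqrt (of_nat (card \<J>))
          * ennreal (norm (u \<mu> - ut \<mu>)) \<and>
      ennreal (norm (u \<mu> - ut \<mu>)) \<le> Delta_loc_g ip N Vs P Vt (a \<mu>) (f \<mu>) (ut \<mu>) \<and>
      Delta_loc_g ip N Vs P Vt (a \<mu>) (f \<mu>) (ut \<mu>) \<le>
        ?\<gamma> / ?\<alpha> * ?cpu * ennsqrt (of_nat (card \<J>)) * ennreal (norm (u \<mu> - ut \<mu>))"
    using rel_l eff_l rel_g eff_g unfolding e_def[symmetric] by (simp only: simp_thms)
qed

end
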